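(* Let $I$ and $J$ be arbitrary sets and let $\{a_i\}_{i\in I}$ and $\{b_j\}_{j\in J}$ be arrays of complex (or real) numbers. Let $A(z)$, $B(z)$ and $C(z)$ be the greedy zeta-functions of $\{a_i\}_{i\in I}$, of $\{b_j\}_{j\in J}$ and of their direct product $\{a_ib_j\}_{(i,j)\in I\times J}$, respectively. Then $$C(z)=A(z)\,B(z)$$ for every complex number $z$ at which all three functions $A$, $B$, $C$ are defined.
   Context: An array of numbers $\{a_i\}_{i\in I}$ over $I$ is a family of complex or real numbers indexed by a set $I$ of arbitrary nature. The direct product of arrays $\{a_i\}_{i\in I}$ and $\{b_j\}_{j\in J}$ is the array $\{a_ib_j\}_{(i,j)\in I\times J}$. For an array $\{a_i\}_{i\in I}$ and a real number $\varepsilon>0$, the $\varepsilon$-partial sum is $\sum_{|a_i|\ge\varepsilon}a_i$ (the sum over all $i\in I$ with $|a_i|\ge\varepsilon$); it exists if and only if it contains a finite number of summands, i.e. the set $\{i\in I : |a_i|\ge\varepsilon\}$ is finite. The greedy sum of the array, denoted $\sum_{i\in I}a_i$, is the limit $\lim_{\varepsilon\to 0^+}\sum_{|a_i|\ge\varepsilon}a_i$ of the $\varepsilon$-partial sums. The array is called greedy summable if it has a greedy sum, i.e. all $\varepsilon$-partial sums ($\varepsilon>0$) exist and this limit exists as a finite number. The greedy zeta-function of an array $\{a_i\}_{i\in I}$ is the function of a complex variable $z$ given by the greedy sum $A(z)=\sum_{i\in I}a_i|a_i|^z$ of the array $\{a_i|a_i|^z\}_{i\in I}$; it is defined at those $z\in\mathbb{C}$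 for which this array is greedy summable. Here $|a_i|^z=e^{z\ln|a_i|}$ with the real logarithm for $a_i\neq 0$, and $a_i|a_i|^z$ is understood to be $0$ when $a_i=0$. *)

theory Defs
  imports "HOL-Analysis.Analysis"
begin

(* An array {a_i} over I is a pair of a total function a and an index set I;
   the values of a outside I are irrelevant. *)

definition direct_product :: "('i \<Rightarrow> complex) \<Rightarrow> ('j \<Rightarrow> complex) \<Rightarrow> 'i \<times> 'j \<Rightarrow> complex"
  where "direct_product a b = (\<lambda>(i, j). a i * b j)"

definition partial_sums_exist :: "('i \<Rightarrow> complex) \<Rightarrow> 'i set \<Rightarrow> bool"
  where "partial_sums_exist a I \<longleftrightarrow> (\<forall>\<epsilon>>0. finite {i \<in> I. norm (a i) \<ge> \<epsilon>})"

(* Only meaningful if the index set of the sum is finite; see partial_sums_exist. *)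
definition partial_sum :: "('i \<Rightarrow> complex) \<Rightarrow> 'i set \<Rightarrow> real \<Rightarrow> complex"
  where "partial_sum a I \<epsilon> = (\<Sum>i \<in> {i \<in> I. norm (a i) \<ge> \<epsilon>}. a i)"

definition greedy_summable :: "('i \<Rightarrow> complex) \<Rightarrow> 'i set \<Rightarrow> bool"
  where "greedy_summable a I \<longleftrightarrow>
    partial_sums_exist a I \<and> (\<exists>s. (partial_sum a I \<longlongrightarrow> s) (at_right 0))"

(* Only meaningful if the array is greedy summable. *)
definition greedy_sum :: "('i \<Rightarrow> complex) \<Rightarrow> 'i set \<Rightarrow> complex"
  where "greedy_sum a I = Lim (at_right 0) (partial_sum a I)"

definition zeta_array :: "('i \<Rightarrow> complex) \<Rightarrow> complex \<Rightarrow> 'i \<Rightarrow> complex"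
  where "zeta_array a z i = a i * complex_of_real (norm (a i)) powr z"

lemma zeta_array_eq:
  "zeta_array a z i =
    (if a i = 0 then 0 else a i * exp (z * complex_of_real (ln (norm (a i)))))"
  by (simp add: zeta_array_def powr_def Ln_of_real)

definition greedy_zeta_domain :: "('i \<Rightarrow> complex) \<Rightarrow> 'i set \<Rightarrow> complex set"
  where "greedy_zeta_domain a I = {z. greedy_summable (zeta_array a z) I}"

definition greedy_zeta :: "('i \<Rightarrow> complex) \<Rightarrow> 'i set \<Rightarrow> complex \<Rightarrow> complex"
  where "greedy_zeta a I z = greedy_sum (zeta_array a z) I"

end

theory Submission
  imports Defs
begin

text \<open>
  The zeta arrays are multiplicative, so it suffices to treat greedy sums.  With
  \<open>S\<^sub>a t\<close> the \<open>exp (-t)\<close>-partial sum of \<open>a\<close>, a pair \<open>(i, j)\<close> contributes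
  \<open>a i * b j * max 0 (x + ln \<bar>a i\<bar> + ln \<bar>b j\<bar>)\<close> to the convolution of \<open>S\<^sub>a\<close> and \<open>S\<^sub>b\<close>
  at \<open>x\<close> as well as to the integral of \<open>S\<^sub>c\<close> over \<open>{..x}\<close>, where \<open>c\<close> is the direct product.
  Hence these two quantities agree.  After division by \<open>x\<close> and the substitution \<open>t = x * s\<close>,
  dominated convergence shows that they tend to the product of the greedy sums of \<open>a\<close> and
  \<open>b\<close> and to the greedy sum of \<open>c\<close>, respectively, as \<open>x\<close> tends to infinity.
\<close>

text \<open>For nonzero factors the logarithms of the norms add up, so the exponentials multiply; if
  a factor vanishes, both sides are 0.\<close>

lemma zeta_array_direct_product:
  "zeta_array (direct_product a b) z = direct_product (zeta_array a z) (zeta_array b z)"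
  by (auto simp: fun_eq_iff zeta_array_eq direct_product_def norm_mult ln_mult ring_distribs exp_add)

section \<open>Vanishing and boundedness of partial sums\<close>

lemma partial_sum_tendsto_greedy_sum:
  assumes "greedy_summable a I"
  shows "(partial_sum a I \<longlongrightarrow> greedy_sum a I) (at_right 0)"
  using assms tendsto_Lim[OF trivial_limit_at_right_real]
  unfolding greedy_summable_def greedy_sum_def by metis

text \<open>Only finitely many entries have norm at least 1, so the array is bounded and large
  thresholds select nothing. This bounds the support of the later integrands.\<close>

lemma partial_sum_eq_0:
  assumes "partial_sums_exist a I"
  obtains L where "L \<ge> 0" "\<And>t. t < -L \<Longrightarrow> partial_sum a I (exp (-t)) = 0"
proof -
  let ?S = "{i \<in> I. norm (a i) \<ge> 1}"
  have fin: "finite ?S" using assms unfolding partial_sums_exist_def by auto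
  \<comment> \<open>The summand 1 makes \<open>K\<close> a strict bound on all norms, also if
    \<open>?S\<close> is empty, and gives \<open>ln K \<ge> 0\<close>.\<close>
  define K where "K = 1 + (\<Sum>i\<in>?S. norm (a i))"
  have K1: "K \<ge> 1" unfolding K_def by (simp add: sum_nonneg)
  have lt: "norm (a i) < K" if "i \<in> I" for i
  proof (cases "norm (a i) \<ge> 1")
    case True
    then have "norm (a i) \<le> (\<Sum>i\<in>?S. norm (a i))"
      using that fin by (intro member_le_sum) auto
    then show ?thesis by (simp add: K_def)
  next
    case False
    then show ?thesis using K1 by linarith
  qed
  show thesis
  proof (rule that[of "ln K"])
    show "ln K \<ge> 0" using K1 by simp
    fix t assume "t < - ln K"
    then have "exp (-t) > exp (ln K)" by simp
    then have "exp (-t) > K" using K1 by simp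
    then have "{i \<in> I. norm (a i) \<ge> exp (-t)} = {}" using lt by force
    then show "partial_sum a I (exp (-t)) = 0" by (simp only: partial_sum_def sum.empty)
  qed
qed

text \<open>Convergence bounds the partial sums for thresholds below some \<open>d\<close>; for
  larger ones, the norms of the finitely many entries above \<open>d\<close> do. This yields the
  constant for dominated convergence.\<close>

lemma partial_sum_bounded:
  assumes "greedy_summable a I"
  obtains M where "M \<ge> 0" "\<And>\<epsilon>. \<epsilon> > 0 \<Longrightarrow> norm (partial_sum a I \<epsilon>) \<le> M"
proof -
  have "\<forall>\<^sub>F \<epsilon> in at_right 0. dist (partial_sum a I \<epsilon>) (greedy_sum a I) < 1"
    using partial_sum_tendsto_greedy_sum[OF assms] by (rule tendstoD) simp
  then obtain d where d: "d > 0"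
    "\<And>\<epsilon>. \<epsilon> > 0 \<Longrightarrow> \<epsilon> < d \<Longrightarrow> dist (partial_sum a I \<epsilon>) (greedy_sum a I) < 1"
    by (auto simp: eventually_at_right_field)
  have fin: "finite {i \<in> I. norm (a i) \<ge> d}"
    using assms d(1) unfolding greedy_summable_def partial_sums_exist_def by auto
  define N where "N = (\<Sum>i \<in> {i \<in> I. norm (a i) \<ge> d}. norm (a i))"
  have N: "N \<ge> 0" unfolding N_def by (simp add: sum_nonneg)
  show thesis
  proof (rule that[of "norm (greedy_sum a I) + 1 + N"])
    show "norm (greedy_sum a I) + 1 + N \<ge> 0" using N by (simp add: add_nonneg_nonneg)
    fix \<epsilon> :: real assume e: "\<epsilon> > 0"
    show "norm (partial_sum a I \<epsilon>) \<le> norm (greedy_sum a I) + 1 + N"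
    proof (cases "\<epsilon> < d")
      case True
      then have "norm (partial_sum a I \<epsilon> - greedy_sum a I) < 1" using d(2) e by (simp add: dist_norm)
      then show ?thesis using N norm_triangle_sub[of "partial_sum a I \<epsilon>" "greedy_sum a I"] by linarith
    next
      case False
      have "norm (partial_sum a I \<epsilon>) \<le> (\<Sum>i \<in> {i \<in> I. norm (a i) \<ge> \<epsilon>}. norm (a i))"
        unfolding partial_sum_def by (rule norm_sum)
      also have "\<dots> \<le> N" unfolding N_def using False by (intro sum_mono2 fin) auto
      finally show ?thesis using norm_ge_zero[of "greedy_sum a I"] by linarith
    qed
  qed
qed

section \<open>Pointwise limits under the scaling \<open>t = x * s\<close>\<close>

lemma partial_sum_exp_tendsto:
  assumes "greedy_summable a I" and "s > 0"
  shows "(\<lambda>n. partial_sum a I (exp (- (real (Suc n) * s)))) \<longlonglongrightarrow> greedy_sum a I"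
proof (rule filterlim_compose[OF partial_sum_tendsto_greedy_sum[OF assms(1)]])
  have "filterlim (\<lambda>n. real (Suc n) * s) at_top sequentially"
    using filterlim_tendsto_pos_mult_at_top[OF tendsto_const assms(2)
        filterlim_compose[OF filterlim_real_sequentially filterlim_Suc]]
    by (simp add: mult.commute)
  then have "(\<lambda>n. exp (- (real (Suc n) * s))) \<longlonglongrightarrow> 0"
    by (intro filterlim_compose[OF exp_at_bot] filterlim_compose[OF filterlim_uminus_at_bot_at_top])
  then show "filterlim (\<lambda>n. exp (- (real (Suc n) * s))) (at_right 0) sequentially"
    by (simp add: filterlim_at)
qed

text \<open>For negative \<open>s\<close> the thresholds grow beyond all norms, so the sequence is
  eventually 0.\<close>

lemma partial_sum_exp_tendsto_0:
  assumes "partial_sums_exist a I" and "s < 0"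
  shows "(\<lambda>n. partial_sum a I (exp (- (real (Suc n) * s)))) \<longlonglongrightarrow> 0"
proof -
  obtain L where L: "L \<ge> 0" "\<And>t. t < -L \<Longrightarrow> partial_sum a I (exp (-t)) = 0"
    using partial_sum_eq_0[OF assms(1)] by blast
  obtain N where N: "real N > L / (- s)" using reals_Archimedean2 by blast
  have "partial_sum a I (exp (- (real (Suc n) * s))) = 0" if "n \<ge> N" for n
  proof (rule L(2))
    have "L / (- s) < real (Suc n)" using N that by linarith
    then show "real (Suc n) * s < - L" using assms(2) by (simp add: field_simps)
  qed
  then show ?thesis by (intro tendsto_eventually eventually_sequentiallyI[of N])
qed

section \<open>The convolution identity\<close>

lemma exp_uminus_le_iff:
  fixes u :: real
  assumes "u > 0"
  shows "exp (- t) \<le> u \<longleftrightarrow> - ln u \<le> t"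
  using assms by (metis exp_le_cancel_iff exp_ln minus_le_iff)

text \<open>Each term integrates to its coefficient times the length of its interval. The hypothesis
  excludes reversed intervals, whose measure is 0 rather than \<open>u p - l p\<close>.\<close>

lemma has_bochner_integral_sum_indicator_Icc:
  fixes c :: "'p \<Rightarrow> 'b::{banach, second_countable_topology}"
  assumes "\<And>p. p \<in> F \<Longrightarrow> l p \<le> u p"
  shows "has_bochner_integral lborel
    (\<lambda>s. \<Sum>p\<in>F. indicator {l p..u p} s *\<^sub>R c p) (\<Sum>p\<in>F. (u p - l p) *\<^sub>R c p)"
proof (rule has_bochner_integral_sum)
  fix p assume "p \<in> F"
  have "has_bochner_integral lborel (indicator {l p..u p}) (measure lborel {l p..u p})"
    by (rule has_bochner_integral_real_indicator) (simp_all add: emeasure_lborel_Icc_eq)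
  then show "has_bochner_integral lborel (\<lambda>s. indicator {l p..u p} s *\<^sub>R c p) ((u p - l p) *\<^sub>R c p)"
    using assms[OF \<open>p \<in> F\<close>] by (intro has_bochner_integral_scaleR_left) simp
qed

text \<open>Both functions are step functions built from the same finite set of pairs. In them the
  pair \<open>(i, j)\<close> carries the intervals \<open>{\<alpha> i..1 - \<beta> j}\<close> and
  \<open>{\<alpha> i + \<beta> j..1}\<close>, which have equal length.\<close>

lemma has_bochner_integral_convolution:
  fixes a :: "'i \<Rightarrow> complex" and b :: "'j \<Rightarrow> complex"
  assumes pe: "partial_sums_exist (direct_product a b) (I \<times> J)" and x: "x > 0"
  obtains v where
    "has_bochner_integral lborel
       (\<lambda>s. partial_sum a I (exp (- (x * s))) * partial_sum b J (exp (- (x * (1 - s))))) v"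
    "has_bochner_integral lborel
       (\<lambda>s. indicator {..1} s *\<^sub>R partial_sum (direct_product a b) (I \<times> J) (exp (- (x * s)))) v"
proof -
  define c where "c = direct_product a b"
  \<comment> \<open>The threshold at \<open>s = 1\<close>: these are exactly the pairs with nonzero
    entries whose intervals are nonempty.\<close>
  define F where "F = {p \<in> I \<times> J. norm (c p) \<ge> exp (- x)}"
  have fin: "finite F" using pe unfolding F_def c_def partial_sums_exist_def by auto
  \<comment> \<open>\<open>\<alpha> i\<close> and \<open>\<beta> j\<close> are the values of
    \<open>s\<close> from which an entry is counted. They are meaningful only for nonzero entries,
    hence the case distinctions on zero below.\<close>
  define \<alpha> where "\<alpha> i = - ln (norm (a i)) / x" for i
  define \<beta> where "\<beta> j = - ln (norm (b j)) / x" for j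
  have a_le: "exp (- (x * s)) \<le> norm (a i) \<longleftrightarrow> \<alpha> i \<le> s" if "a i \<noteq> 0" for i s
    using that x by (simp add: exp_uminus_le_iff \<alpha>_def field_simps)
  have b_le: "exp (- (x * s)) \<le> norm (b j) \<longleftrightarrow> \<beta> j \<le> s" if "b j \<noteq> 0" for j s
    using that x by (simp add: exp_uminus_le_iff \<beta>_def field_simps)
  have c_le: "exp (- (x * s)) \<le> norm (c (i, j)) \<longleftrightarrow> \<alpha> i + \<beta> j \<le> s"
    if "a i \<noteq> 0" "b j \<noteq> 0" for i j s
    using that x
    by (simp add: exp_uminus_le_iff \<alpha>_def \<beta>_def c_def direct_product_def norm_mult ln_mult field_simps)
  have F_iff: "(i, j) \<in> F \<longleftrightarrow> i \<in> I \<and> j \<in> J \<and> a i \<noteq> 0 \<and> b j \<noteq> 0 \<and> \<alpha> i + \<beta> j \<le> 1" for i j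
  proof (cases "a i = 0 \<or> b j = 0")
    case True
    then show ?thesis by (auto simp: F_def c_def direct_product_def)
  next
    case False
    then show ?thesis using c_le[of i j 1] by (auto simp: F_def)
  qed
  \<comment> \<open>The index \<open>i\<close> is counted from \<open>s = \<alpha> i\<close> on, and
    \<open>j\<close> as long as \<open>\<beta> j \<le> 1 - s\<close>.\<close>
  have prod_eq: "partial_sum a I (exp (- (x * s))) * partial_sum b J (exp (- (x * (1 - s)))) =
      (\<Sum>p\<in>F. indicator {\<alpha> (fst p)..1 - \<beta> (snd p)} s *\<^sub>R c p)" for s
  proof -
    have in_F: "i \<in> I \<and> exp (- (x * s)) \<le> norm (a i) \<and> j \<in> J \<and> exp (- (x * (1 - s))) \<le> norm (b j)
        \<longleftrightarrow> (i, j) \<in> F \<and> s \<in> {\<alpha> i..1 - \<beta> j}" for i j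
    proof (cases "a i = 0 \<or> b j = 0")
      case True
      then show ?thesis by (auto simp: F_iff)
    next
      case False
      then show ?thesis using a_le[of i s] b_le[of j "1 - s"] by (auto simp: F_iff)
    qed
    have sets: "{i \<in> I. norm (a i) \<ge> exp (- (x * s))} \<times> {j \<in> J. norm (b j) \<ge> exp (- (x * (1 - s)))}
       = {p \<in> F. s \<in> {\<alpha> (fst p)..1 - \<beta> (snd p)}}"
      unfolding set_eq_iff using in_F by (simp add: mem_Times_iff conj_ac)
    have "partial_sum a I (exp (- (x * s))) * partial_sum b J (exp (- (x * (1 - s)))) =
       (\<Sum>p \<in> {p \<in> F. s \<in> {\<alpha> (fst p)..1 - \<beta> (snd p)}}. c p)"
      unfolding partial_sum_def sum_product sum.cartesian_product sets
      by (rule sum.cong) (auto simp: c_def direct_product_def)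
    also have "\<dots> = (\<Sum>p\<in>F. if s \<in> {\<alpha> (fst p)..1 - \<beta> (snd p)} then c p else 0)"
      by (rule sum.inter_filter[OF fin])
    also have "\<dots> = (\<Sum>p\<in>F. indicator {\<alpha> (fst p)..1 - \<beta> (snd p)} s *\<^sub>R c p)"
      by (rule sum.cong) (auto simp: indicator_def)
    finally show ?thesis .
  qed
  \<comment> \<open>The pair enters at \<open>\<alpha> i + \<beta> j\<close>, and the cut-off at 1
    closes its interval.\<close>
  have cut_eq: "indicator {..1} s *\<^sub>R partial_sum c (I \<times> J) (exp (- (x * s))) =
      (\<Sum>p\<in>F. indicator {\<alpha> (fst p) + \<beta> (snd p)..1} s *\<^sub>R c p)" for s
  proof (cases "s \<le> 1")
    case True
    have in_F: "i \<in> I \<and> j \<in> J \<and> exp (- (x * s)) \<le> norm (c (i, j))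
        \<longleftrightarrow> (i, j) \<in> F \<and> s \<in> {\<alpha> i + \<beta> j..1}" for i j
    proof (cases "a i = 0 \<or> b j = 0")
      case True
      then show ?thesis by (auto simp: F_iff c_def direct_product_def)
    next
      case False
      then show ?thesis using c_le[of i j s] \<open>s \<le> 1\<close> by (auto simp: F_iff)
    qed
    have sets: "{p \<in> I \<times> J. norm (c p) \<ge> exp (- (x * s))}
       = {p \<in> F. s \<in> {\<alpha> (fst p) + \<beta> (snd p)..1}}"
      unfolding set_eq_iff using in_F by (simp add: mem_Times_iff conj_ac)
    have "partial_sum c (I \<times> J) (exp (- (x * s))) =
        (\<Sum>p\<in>F. if s \<in> {\<alpha> (fst p) + \<beta> (snd p)..1} then c p else 0)"
      unfolding partial_sum_def sets by (rule sum.inter_filter[OF fin])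
    also have "\<dots> = (\<Sum>p\<in>F. indicator {\<alpha> (fst p) + \<beta> (snd p)..1} s *\<^sub>R c p)"
      by (rule sum.cong) (auto simp: indicator_def)
    finally show ?thesis using True by simp
  next
    case False
    then show ?thesis by simp
  qed
  have le: "\<alpha> (fst p) + \<beta> (snd p) \<le> 1" if "p \<in> F" for p
    using that F_iff[of "fst p" "snd p"] by simp
  let ?v = "\<Sum>p\<in>F. (1 - (\<alpha> (fst p) + \<beta> (snd p))) *\<^sub>R c p"
  show thesis
  proof (rule that[of ?v])
    have "has_bochner_integral lborel
       (\<lambda>s. \<Sum>p\<in>F. indicator {\<alpha> (fst p)..1 - \<beta> (snd p)} s *\<^sub>R c p)
       (\<Sum>p\<in>F. (1 - \<beta> (snd p) - \<alpha> (fst p)) *\<^sub>R c p)"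
      by (rule has_bochner_integral_sum_indicator_Icc) (use le in force)
    moreover have "(\<Sum>p\<in>F. (1 - \<beta> (snd p) - \<alpha> (fst p)) *\<^sub>R c p) = ?v"
      by (simp add: algebra_simps)
    ultimately show "has_bochner_integral lborel
       (\<lambda>s. partial_sum a I (exp (- (x * s))) * partial_sum b J (exp (- (x * (1 - s))))) ?v"
      by (simp only: prod_eq)
    show "has_bochner_integral lborel
       (\<lambda>s. indicator {..1} s *\<^sub>R partial_sum (direct_product a b) (I \<times> J) (exp (- (x * s)))) ?v"
      unfolding c_def[symmetric] cut_eq
      by (rule has_bochner_integral_sum_indicator_Icc) (use le in auto)
  qed
qed

section \<open>Passage to the limit under the integral\<close>

text \<open>Dominated convergence with majorant \<open>M\<close> on \<open>{p..q}\<close>: the limit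
  function is \<open>l\<close> on the unit interval, of length 1. The points 0 and 1, where no
  convergence is assumed, form a null set.\<close>

lemma integral_limit_unit_interval:
  fixes f :: "nat \<Rightarrow> real \<Rightarrow> complex"
  assumes meas: "\<And>n. f n \<in> borel_measurable lborel"
    and lim: "\<And>s. 0 < s \<Longrightarrow> s < 1 \<Longrightarrow> (\<lambda>n. f n s) \<longlonglongrightarrow> l"
    and lim0: "\<And>s. s < 0 \<or> s > 1 \<Longrightarrow> (\<lambda>n. f n s) \<longlonglongrightarrow> 0"
    and bound: "\<And>n s. norm (f n s) \<le> M"
    and support: "\<And>n s. s \<notin> {p..q} \<Longrightarrow> f n s = 0"
  shows "(\<lambda>n. integral\<^sup>L lborel (f n)) \<longlonglongrightarrow> l"
proof -
  let ?g = "\<lambda>s::real. indicator {0..1} s *\<^sub>R l"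
  have "(\<lambda>n. integral\<^sup>L lborel (f n)) \<longlonglongrightarrow> integral\<^sup>L lborel ?g"
  proof (rule integral_dominated_convergence[where w = "\<lambda>s. indicator {p..q} s * M"])
    show "?g \<in> borel_measurable lborel" by simp
    show "f n \<in> borel_measurable lborel" for n by (rule meas)
    show "integrable lborel (\<lambda>s. indicator {p..q} s * M)"
      by (intro integrable_mult_left integrable_real_indicator) (simp_all add: emeasure_lborel_Icc_eq)
    show "AE s in lborel. (\<lambda>n. f n s) \<longlonglongrightarrow> ?g s"
      using AE_lborel_singleton[of "0::real"] AE_lborel_singleton[of "1::real"]
    proof eventually_elim
      case (elim s)
      then consider "0 < s" "s < 1" | "s < 0 \<or> s > 1" by linarith
      then show ?case using lim lim0 by cases (auto simp: indicator_def)
    qed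
    show "AE s in lborel. norm (f n s) \<le> indicator {p..q} s * M" for n
    proof (rule AE_I2)
      fix s show "norm (f n s) \<le> indicator {p..q} s * M"
        using bound[of n s] support[of s n] by (cases "s \<in> {p..q}") auto
    qed
  qed
  moreover have "integral\<^sup>L lborel ?g = l" by simp
  ultimately show ?thesis by simp
qed

lemma greedy_sum_direct_product:
  assumes a: "greedy_summable a I" and b: "greedy_summable b J"
    and c: "greedy_summable (direct_product a b) (I \<times> J)"
  shows "greedy_sum (direct_product a b) (I \<times> J) = greedy_sum a I * greedy_sum b J"
proof -
  let ?A = "\<lambda>t. partial_sum a I (exp (- t))"
  let ?B = "\<lambda>t. partial_sum b J (exp (- t))"
  let ?C = "\<lambda>t. partial_sum (direct_product a b) (I \<times> J) (exp (- t))"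
  have pe: "partial_sums_exist a I" "partial_sums_exist b J"
    "partial_sums_exist (direct_product a b) (I \<times> J)"
    using assms unfolding greedy_summable_def by blast+
  \<comment> \<open>Here \<open>x = real (Suc n)\<close>, which is positive for every
    \<open>n\<close>, as the convolution identity requires.\<close>
  define f where "f n s = ?A (real (Suc n) * s) * ?B (real (Suc n) * (1 - s))" for n s
  define g where "g n s = indicator {..1} s *\<^sub>R ?C (real (Suc n) * s)" for n and s :: real
  have "\<exists>v. has_bochner_integral lborel (f n) v \<and> has_bochner_integral lborel (g n) v" for n
  proof -
    obtain v where "has_bochner_integral lborel (f n) v" "has_bochner_integral lborel (g n) v"
      unfolding f_def g_def
      by (rule has_bochner_integral_convolution[OF pe(3), of "real (Suc n)"]) auto
    then show ?thesis by blast
  qed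
  then obtain v where v: "has_bochner_integral lborel (f n) (v n)"
    "has_bochner_integral lborel (g n) (v n)" for n by metis
  obtain L\<^sub>a where L\<^sub>a: "L\<^sub>a \<ge> 0" "\<And>t. t < - L\<^sub>a \<Longrightarrow> ?A t = 0"
    using partial_sum_eq_0[OF pe(1)] by blast
  obtain L\<^sub>b where L\<^sub>b: "L\<^sub>b \<ge> 0" "\<And>t. t < - L\<^sub>b \<Longrightarrow> ?B t = 0"
    using partial_sum_eq_0[OF pe(2)] by blast
  obtain L\<^sub>c where L\<^sub>c: "L\<^sub>c \<ge> 0" "\<And>t. t < - L\<^sub>c \<Longrightarrow> ?C t = 0"
    using partial_sum_eq_0[OF pe(3)] by blast
  obtain M\<^sub>a where M\<^sub>a: "M\<^sub>a \<ge> 0" "\<And>\<epsilon>. \<epsilon> > 0 \<Longrightarrow> norm (partial_sum a I \<epsilon>) \<le> M\<^sub>a"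
    using partial_sum_bounded[OF a] by blast
  obtain M\<^sub>b where M\<^sub>b: "M\<^sub>b \<ge> 0" "\<And>\<epsilon>. \<epsilon> > 0 \<Longrightarrow> norm (partial_sum b J \<epsilon>) \<le> M\<^sub>b"
    using partial_sum_bounded[OF b] by blast
  obtain M\<^sub>c where M\<^sub>c: "M\<^sub>c \<ge> 0"
    "\<And>\<epsilon>. \<epsilon> > 0 \<Longrightarrow> norm (partial_sum (direct_product a b) (I \<times> J) \<epsilon>) \<le> M\<^sub>c"
    using partial_sum_bounded[OF c] by blast
  \<comment> \<open>Since the factor is at least 1 and \<open>t\<close> is negative, scaling only
    moves \<open>t\<close> further down. So the supports lie in an interval independent of
    \<open>n\<close>.\<close>
  have scale: "real (Suc n) * t < - L" if "L \<ge> 0" "t < - L" for n L t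
  proof -
    have "real n * t \<le> 0" using that by (intro mult_nonneg_nonpos) auto
    then show ?thesis using that by (simp add: algebra_simps)
  qed
  have lim_f: "(\<lambda>n. integral\<^sup>L lborel (f n)) \<longlonglongrightarrow> greedy_sum a I * greedy_sum b J"
  proof (rule integral_limit_unit_interval[where M = "M\<^sub>a * M\<^sub>b" and p = "- L\<^sub>a" and q = "1 + L\<^sub>b"])
    show "f n \<in> borel_measurable lborel" for n
      using v(1)[of n] unfolding has_bochner_integral_iff
      by (blast intro: borel_measurable_integrable)
    show "(\<lambda>n. f n s) \<longlonglongrightarrow> greedy_sum a I * greedy_sum b J" if "0 < s" "s < 1" for s
      unfolding f_def using that by (intro tendsto_mult partial_sum_exp_tendsto a b) auto
    \<comment> \<open>Outside the unit interval one of \<open>s\<close> and \<open>1 - s\<close> is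
      negative, so one factor tends to 0 while the other converges to its greedy sum.\<close>
    show "(\<lambda>n. f n s) \<longlonglongrightarrow> 0" if "s < 0 \<or> s > 1" for s
    proof (cases "s < 0")
      case True
      then have "(\<lambda>n. f n s) \<longlonglongrightarrow> 0 * greedy_sum b J"
        unfolding f_def
        by (intro tendsto_mult partial_sum_exp_tendsto partial_sum_exp_tendsto_0 b pe) auto
      then show ?thesis by simp
    next
      case False
      with that have "(\<lambda>n. f n s) \<longlonglongrightarrow> greedy_sum a I * 0"
        unfolding f_def
        by (intro tendsto_mult partial_sum_exp_tendsto partial_sum_exp_tendsto_0 a pe) auto
      then show ?thesis by simp
    qed
    show "norm (f n s) \<le> M\<^sub>a * M\<^sub>b" for n s
      unfolding f_def norm_mult by (intro mult_mono M\<^sub>a M\<^sub>b) auto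
    \<comment> \<open>To the left of the interval the factor from \<open>a\<close> vanishes, to the
      right the factor from \<open>b\<close>.\<close>
    show "f n s = 0" if "s \<notin> {- L\<^sub>a..1 + L\<^sub>b}" for n s
    proof (cases "s < - L\<^sub>a")
      case True
      then show ?thesis unfolding f_def using L\<^sub>a(2)[OF scale[OF L\<^sub>a(1)]] by simp
    next
      case False
      with that have "1 - s < - L\<^sub>b" by auto
      then show ?thesis unfolding f_def using L\<^sub>b(2)[OF scale[OF L\<^sub>b(1)]] by simp
    qed
  qed
  have lim_g: "(\<lambda>n. integral\<^sup>L lborel (g n)) \<longlonglongrightarrow> greedy_sum (direct_product a b) (I \<times> J)"
  proof (rule integral_limit_unit_interval[where M = M\<^sub>c and p = "- L\<^sub>c" and q = 1])
    show "g n \<in> borel_measurable lborel" for n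
      using v(2)[of n] unfolding has_bochner_integral_iff
      by (blast intro: borel_measurable_integrable)
    show "(\<lambda>n. g n s) \<longlonglongrightarrow> greedy_sum (direct_product a b) (I \<times> J)" if "0 < s" "s < 1" for s
      using partial_sum_exp_tendsto[OF c that(1)] that(2) by (simp add: g_def)
    show "(\<lambda>n. g n s) \<longlonglongrightarrow> 0" if "s < 0 \<or> s > 1" for s
      using partial_sum_exp_tendsto_0[OF pe(3), of s] that by (cases "s < 0") (auto simp: g_def)
    show "norm (g n s) \<le> M\<^sub>c" for n s
      unfolding g_def using M\<^sub>c by (cases "s \<le> 1") auto
    show "g n s = 0" if "s \<notin> {- L\<^sub>c..1}" for n s
      using that L\<^sub>c(2)[OF scale[OF L\<^sub>c(1), of s n]] by (cases "s \<le> 1") (auto simp: g_def)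
  qed
  have "integral\<^sup>L lborel (g n) = integral\<^sup>L lborel (f n)" for n
    using v by (simp add: has_bochner_integral_iff)
  with lim_g have "(\<lambda>n. integral\<^sup>L lborel (f n)) \<longlonglongrightarrow> greedy_sum (direct_product a b) (I \<times> J)"
    by simp
  then show ?thesis using lim_f by (rule LIMSEQ_unique)
qed

text \<open>At a fixed \<open>z\<close> this is the product rule for greedy sums, applied to the two
  zeta arrays.\<close>

theorem theorem2:
  fixes I :: "'i set" and J :: "'j set"
    and a :: "'i \<Rightarrow> complex" and b :: "'j \<Rightarrow> complex" and z :: complex
  assumes "z \<in> greedy_zeta_domain a I"
    and "z \<in> greedy_zeta_domain b J"
    and "z \<in> greedy_zeta_domain (direct_product a b) (I \<times> J)"
  shows "greedy_zeta (direct_product a b) (I \<times> J) z = greedy_zeta a I z * greedy_zeta b J z"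
  using assms greedy_sum_direct_product[of "zeta_array a z" I "zeta_array b z" J]
  by (simp add: greedy_zeta_domain_def greedy_zeta_def zeta_array_direct_product)

end
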